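(* Let $X,Z$ be real normed spaces and $K\subset X$ a closed convex pointed cone with $\operatorname{int}K\neq\emptyset$. Let $F,H:Z\rightrightarrows X$ be set-valued maps, $M\subset Z$ a nonempty closed set, $e\in\operatorname{int}K$, $\mu>0$, $L\in(0,\mu)$, and $\varepsilon>0$. Suppose that there exist $\overline z,z_\varepsilon\in M$ such that for all $z\in M$: (i) $F(\overline z)\not\subset F(z)-\mu\|z-\overline z\|e+\operatorname{int}K$; (ii) $H(z)+L\|z-\overline z\|e\subset H(\overline z)+K$; (iii) $(F+H)(z)\subset(F+H)(z_\varepsilon)-\varepsilon e+K$. Moreover, suppose that $F(z_\varepsilon)$ is $K$-convex and $H(\overline z)$ is weakly $K$-compact. Then $$\|z_\varepsilon-\overline z\|\le\frac{\varepsilon}{\mu-L}.$$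
   Context: Sums of sets are Minkowski sums, and $(F+H)(z)=F(z)+H(z)$. A cone $K$ is pointed if $K\cap(-K)=\{0\}$. A set $S\subset X$ is $K$-convex if $S+K$ is convex. A nonempty set $S\subset X$ is weakly $K$-compact if from every cover of $S$ by sets of the form $U+K$, with $U\subset X$ weakly open, one can extract a finite subcover. *)

theory Defs
  imports "HOL-Analysis.Analysis" "HOL-Library.Set_Algebras" "HOL-Library.Function_Algebras"
begin

text \<open>
  Sums of sets are the Minkowski sums of \<^theory>\<open>HOL-Library.Set_Algebras\<close>; the sum of two
  set-valued maps \<open>'z \<Rightarrow> 'x set\<close> is the pointwise one of
  \<^theory>\<open>HOL-Library.Function_Algebras\<close>. Translates of a set are Minkowski sums with a singleton.
\<close>

definition pointed :: "'x::real_vector set \<Rightarrow> bool"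
  where "pointed K \<longleftrightarrow> K \<inter> uminus ` K = {0}"

definition K_convex :: "'x::real_vector set \<Rightarrow> 'x set \<Rightarrow> bool"
  where "K_convex K S \<longleftrightarrow> convex (S + K)"

text \<open>The coarsest topology making all continuous linear functionals continuous.\<close>

definition weak_topology :: "'x::real_normed_vector topology"
  where "weak_topology =
    topology_generated_by {f -` V | (f :: 'x \<Rightarrow> real) V. bounded_linear f \<and> open V}"

definition weakly_K_compact :: "'x::real_normed_vector set \<Rightarrow> 'x set \<Rightarrow> bool"
  where "weakly_K_compact K S \<longleftrightarrow>
    S \<noteq> {} \<and>
    (\<forall>\<C>. (\<forall>C\<in>\<C>. \<exists>U. openin weak_topology U \<and> C = U + K) \<and> S \<subseteq> \<Union>\<C> \<longrightarrow>
         (\<exists>\<D>\<subseteq>\<C>. finite \<D> \<and> S \<subseteq> \<Union>\<D>))"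

end

theory Submission
  imports Defs
begin

text \<open>
  With \<open>t = \<parallel>zeps - zbar\<parallel>\<close>, conditions (iii) at \<open>zbar\<close> and (ii) at \<open>zeps\<close> give
  \<open>F zbar + H zbar + (\<epsilon> + L t) e \<subseteq> F zeps + H zbar + K\<close>. The set \<open>H zbar\<close> can be cancelled at the
  price of a closure, as in Radstrom's lemma: a point outside the closure of the convex set
  \<open>F zeps + K\<close> is strictly separated from it by a continuous functional that is nonnegative on
  \<open>K\<close>, and such functionals are bounded below on weakly \<open>K\<close>-compact sets. If \<open>\<epsilon> + L t < \<mu> t\<close>, the
  positive multiple of \<open>e\<close> left over absorbs the closure into \<open>interior K\<close>, contradicting (i) at
  \<open>zeps\<close>. The separation in arbitrary normed spaces rests on the Mazur-Orlicz form of the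
  Hahn-Banach theorem, obtained from Zorn's lemma: minimal sublinear functionals are linear.
\<close>

section \<open>Sublinear functionals, Hahn-Banach and strict separation\<close>

definition sublinear :: "('a::real_vector \<Rightarrow> real) \<Rightarrow> bool"
  where "sublinear p \<longleftrightarrow>
    (\<forall>x y. p (x + y) \<le> p x + p y) \<and> (\<forall>t\<ge>0. \<forall>x. p (t *\<^sub>R x) = t * p x)"

lemma sublinear_add: "sublinear p \<Longrightarrow> p (x + y) \<le> p x + p y"
  and sublinear_scaleR: "sublinear p \<Longrightarrow> 0 \<le> t \<Longrightarrow> p (t *\<^sub>R x) = t * p x"
  by (auto simp: sublinear_def)

lemma sublinear_0: "sublinear p \<Longrightarrow> p 0 = 0"
  using sublinear_scaleR[of p 0 0] by simp

lemma sublinear_minus_ge: "sublinear p \<Longrightarrow> - p (- x) \<le> p x"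
  using sublinear_add[of p x "- x"] sublinear_0[of p] by simp

text \<open>The one-sided bound suffices for homogeneity: applied with the factor \<open>1/t\<close>
  to the vector \<open>t *\<^sub>R x\<close>, it yields the reverse inequality.\<close>

lemma sublinearI:
  assumes add: "\<And>x y. p (x + y) \<le> p x + p y"
    and scale: "\<And>t x. 0 < t \<Longrightarrow> p (t *\<^sub>R x) \<le> t * p x"
    and zero: "p 0 = 0"
  shows "sublinear p"
  unfolding sublinear_def
proof (intro conjI allI impI)
  fix t :: real and x assume "0 \<le> t"
  show "p (t *\<^sub>R x) = t * p x"
  proof (cases "t = 0")
    case False
    with \<open>0 \<le> t\<close> have "0 < t" by simp
    have "p ((1/t) *\<^sub>R (t *\<^sub>R x)) \<le> (1/t) * p (t *\<^sub>R x)"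
      using \<open>0 < t\<close> by (intro scale) simp
    then have "t * p x \<le> p (t *\<^sub>R x)"
      using \<open>0 < t\<close> by (simp add: field_simps)
    with scale[OF \<open>0 < t\<close>, of x] show ?thesis by simp
  qed (simp add: zero)
qed (rule add)

lemma sublinear_norm: "sublinear (norm :: 'a::real_normed_vector \<Rightarrow> real)"
  by (intro sublinearI) (auto intro: norm_triangle_ineq)

text \<open>Used twice: a singleton \<open>D\<close> shows that minimal sublinear functionals are
  odd, and a general convex \<open>D\<close> gives \<open>mazur_orlicz\<close>.\<close>

lemma sublinear_minorant_ge_on_convex:
  fixes p :: "'a::real_vector \<Rightarrow> real"
  assumes p: "sublinear p" and "convex D" "D \<noteq> {}" and ge: "\<And>d. d \<in> D \<Longrightarrow> c \<le> p d"
  obtains q where "sublinear q" "\<And>x. q x \<le> p x" "\<And>d. d \<in> D \<Longrightarrow> q (- d) \<le> - c"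
proof -
  \<comment> \<open>The largest sublinear functional below \<open>p\<close> that is at most \<open>- c\<close> on \<open>- D\<close>.\<close>
  define V where "V x = {p (x + t *\<^sub>R d) - t * c | t d. 0 \<le> t \<and> d \<in> D}" for x
  define q where "q x = Inf (V x)" for x
  have ne: "V x \<noteq> {}" for x
    using \<open>D \<noteq> {}\<close> by (auto simp: V_def intro: exI[of _ "0::real"])
  \<comment> \<open>A bound uniform in \<open>t\<close> and \<open>d\<close>, so that the real
    infimum \<open>Inf (V x)\<close> is a genuine one. This is where \<open>c \<le> p d\<close> on
    \<open>D\<close> enters.\<close>
  have lb: "- p (- x) \<le> v" if "v \<in> V x" for x v
  proof -
    from that obtain t d where td: "v = p (x + t *\<^sub>R d) - t * c" "0 \<le> t" "d \<in> D"
      by (auto simp: V_def)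
    have "t * c \<le> p (t *\<^sub>R d)"
      using ge[OF td(3)] td(2) by (simp add: sublinear_scaleR[OF p] mult_left_mono)
    also have "\<dots> \<le> p (x + t *\<^sub>R d) + p (- x)"
      using sublinear_add[OF p, of "x + t *\<^sub>R d" "- x"] by simp
    finally show ?thesis by (simp add: td(1))
  qed
  have bdd: "bdd_below (V x)" for x
    using lb by (auto simp: bdd_below_def)
  have q_le: "q x \<le> p (x + t *\<^sub>R d) - t * c" if "0 \<le> t" "d \<in> D" for x t d
    unfolding q_def using that bdd by (intro cInf_lower) (auto simp: V_def)
  have q_greatest: "m \<le> q x" if "\<And>t d. 0 \<le> t \<Longrightarrow> d \<in> D \<Longrightarrow> m \<le> p (x + t *\<^sub>R d) - t * c" for m x
    unfolding q_def using that ne by (intro cInf_greatest) (auto simp: V_def)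
  obtain d0 where d0: "d0 \<in> D" using \<open>D \<noteq> {}\<close> by auto
  have q_le_p: "q x \<le> p x" for x
    using q_le[of 0 d0 x] d0 by simp
  have q_minus: "q (- d) \<le> - c" if "d \<in> D" for d
    using q_le[of 1 d "- d"] that sublinear_0[OF p] by simp
  have add: "q (x + y) \<le> q x + q y" for x y
  proof -
    have *: "q (x + y) \<le> (p (x + s *\<^sub>R a) - s * c) + (p (y + t *\<^sub>R b) - t * c)"
      if st: "0 \<le> s" "a \<in> D" "0 \<le> t" "b \<in> D" for s t a b
    proof -
      \<comment> \<open>Convexity merges the two displacements into one: \<open>d\<close> is the
        weighted mean of \<open>a\<close> and \<open>b\<close>. If both weights vanish, any point of
        \<open>D\<close> serves.\<close>
      obtain d where d: "d \<in> D" "s *\<^sub>R a + t *\<^sub>R b = (s + t) *\<^sub>R d"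
      proof (cases "s + t = 0")
        case True
        with st have "s = 0" "t = 0" by auto
        with d0 that show ?thesis by auto
      next
        case False
        then have "(s / (s + t)) *\<^sub>R a + (t / (s + t)) *\<^sub>R b \<in> D"
          using st by (intro convexD[OF \<open>convex D\<close>]) (auto simp flip: add_divide_distrib)
        with False show ?thesis
          by (intro that) (auto simp: scaleR_add_right)
      qed
      have "q (x + y) \<le> p ((x + y) + (s + t) *\<^sub>R d) - (s + t) * c"
        using st d by (intro q_le) auto
      also have "(x + y) + (s + t) *\<^sub>R d = (x + s *\<^sub>R a) + (y + t *\<^sub>R b)"
        unfolding d(2)[symmetric] by simp
      also have "p \<dots> - (s + t) * c \<le> (p (x + s *\<^sub>R a) + p (y + t *\<^sub>R b)) - (s + t) * c"
        using sublinear_add[OF p] by simp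
      finally show ?thesis by (simp add: algebra_simps)
    qed
    \<comment> \<open>The two infima are taken one after the other: first over \<open>(t, b)\<close>
      with \<open>(s, a)\<close> fixed, then over \<open>(s, a)\<close>.\<close>
    have "q (x + y) - (p (x + s *\<^sub>R a) - s * c) \<le> q y" if "0 \<le> s" "a \<in> D" for s a
      using that * by (intro q_greatest) (simp add: diff_le_eq add.commute)
    then have "q (x + y) - q y \<le> q x"
      by (intro q_greatest) (smt (verit))
    then show ?thesis by simp
  qed
  have scale: "q (s *\<^sub>R x) \<le> s * q x" if "0 < s" for s x
  proof -
    have "q (s *\<^sub>R x) / s \<le> q x"
    proof (intro q_greatest)
      fix t d assume td: "(0::real) \<le> t" "d \<in> D"
      have "q (s *\<^sub>R x) \<le> p (s *\<^sub>R x + (s * t) *\<^sub>R d) - (s * t) * c"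
        using td that by (intro q_le) auto
      also have "s *\<^sub>R x + (s * t) *\<^sub>R d = s *\<^sub>R (x + t *\<^sub>R d)"
        by (simp add: scaleR_add_right)
      also have "p \<dots> = s * p (x + t *\<^sub>R d)"
        using that by (intro sublinear_scaleR[OF p]) simp
      finally show "q (s *\<^sub>R x) / s \<le> p (x + t *\<^sub>R d) - t * c"
        using that by (simp add: field_simps)
    qed
    with that show ?thesis by (simp add: field_simps)
  qed
  have "q 0 = 0"
  proof (rule antisym)
    show "q 0 \<le> 0" using q_le_p[of 0] sublinear_0[OF p] by simp
    show "0 \<le> q 0"
      unfolding q_def using ne lb[of _ 0] sublinear_0[OF p] by (intro cInf_greatest) auto
  qed
  with add scale have "sublinear q" by (intro sublinearI)
  with q_le_p q_minus that show thesis by blast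
qed

text \<open>Zorn's lemma for the reversed pointwise order: a nonempty chain of sublinear functionals
  below \<open>p\<close> has its pointwise infimum as a bound, which is finite because every member
  is at least \<open>- p (- x)\<close> at \<open>x\<close>.\<close>

lemma minimal_sublinear_minorant:
  fixes p :: "'a::real_vector \<Rightarrow> real"
  assumes p: "sublinear p"
  obtains q where "sublinear q" "\<And>x. q x \<le> p x"
    "\<And>r. sublinear r \<Longrightarrow> (\<And>x. r x \<le> q x) \<Longrightarrow> r = q"
proof -
  define A where "A = {q. sublinear q \<and> q \<le> p}"
  define P :: "('a \<Rightarrow> real) \<Rightarrow> ('a \<Rightarrow> real) \<Rightarrow> bool" where "P f g \<longleftrightarrow> g \<le> f" for f g
  have "\<exists>m\<in>A. \<forall>a\<in>A. P m a \<longrightarrow> a = m"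
  proof (rule predicate_Zorn)
    show "partial_order_on A (relation_of P A)"
      by (rule partial_order_on_relation_ofI) (auto simp: P_def)
  next
    fix C assume "C \<in> Chains (relation_of P A)"
    then have CA: "C \<subseteq> A" and chain: "\<And>f g. f \<in> C \<Longrightarrow> g \<in> C \<Longrightarrow> f \<le> g \<or> g \<le> f"
      by (auto simp: Chains_def relation_of_def P_def)
    show "\<exists>u\<in>A. \<forall>a\<in>C. P a u"
    proof (cases "C = {}")
      case True
      with p show ?thesis by (auto simp: A_def)
    next
      case False
      define u where "u x = (INF q\<in>C. q x)" for x
      have sub: "sublinear q" and le: "q x \<le> p x" if "q \<in> C" for q x
        using that CA by (auto simp: A_def le_fun_def)
      have lb: "- p (- x) \<le> q x" if "q \<in> C" for q x
        using sublinear_minus_ge[OF sub[OF that], of x] le[OF that, of "- x"] by simp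
      have lower: "u x \<le> q x" if "q \<in> C" for q x
        unfolding u_def using lb that by (intro cINF_lower bdd_belowI2[of _ "- p (- x)"]) auto
      have greatest: "m \<le> u x" if "\<And>q. q \<in> C \<Longrightarrow> m \<le> q x" for m x
        unfolding u_def using False that by (intro cINF_greatest) auto
      obtain q0 where q0: "q0 \<in> C" using False by auto
      have "sublinear u"
      proof (rule sublinearI)
        fix x y
        \<comment> \<open>The smaller of \<open>f\<close> and \<open>g\<close> can be used at both
          \<open>x\<close> and \<open>y\<close>; hence an infimum over a chain stays
          subadditive.\<close>
        have *: "u (x + y) \<le> f x + g y" if fg: "f \<in> C" "g \<in> C" for f g
          using chain[OF fg]
        proof
          assume "f \<le> g"
          then show ?thesis
            using lower[OF fg(1), of "x + y"] sublinear_add[OF sub[OF fg(1)], of x y]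
            by (smt (verit) le_funE)
        next
          assume "g \<le> f"
          then show ?thesis
            using lower[OF fg(2), of "x + y"] sublinear_add[OF sub[OF fg(2)], of x y]
            by (smt (verit) le_funE)
        qed
        have "u (x + y) - f x \<le> u y" if "f \<in> C" for f
          using *[OF that] by (intro greatest) (simp add: algebra_simps)
        then have "u (x + y) - u y \<le> u x"
          by (intro greatest) (smt (verit))
        then show "u (x + y) \<le> u x + u y" by simp
      next
        fix t :: real and x assume "0 < t"
        have "u (t *\<^sub>R x) / t \<le> u x"
        proof (rule greatest)
          fix q assume "q \<in> C"
          then show "u (t *\<^sub>R x) / t \<le> q x"
            using lower[of q "t *\<^sub>R x"] sublinear_scaleR[OF sub, of q t x] \<open>0 < t\<close>
            by (simp add: field_simps)
        qed
        with \<open>0 < t\<close> show "u (t *\<^sub>R x) \<le> t * u x" by (simp add: field_simps)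
      next
        show "u 0 = 0"
        proof (rule antisym)
          show "u 0 \<le> 0" using lower[OF q0, of 0] sublinear_0[OF sub[OF q0]] by simp
          show "0 \<le> u 0" by (rule greatest) (simp add: sublinear_0[OF sub])
        qed
      qed
      moreover have "u \<le> p"
        using order_trans[OF lower[OF q0] le[OF q0]] by (simp add: le_fun_def)
      ultimately show ?thesis
        using lower by (auto simp: A_def P_def le_fun_def)
    qed
  qed
  then obtain q where q: "sublinear q" "q \<le> p"
    and min: "\<And>r. sublinear r \<Longrightarrow> r \<le> p \<Longrightarrow> r \<le> q \<Longrightarrow> r = q"
    by (auto simp: A_def P_def)
  show thesis
  proof
    show "sublinear q" "\<And>x. q x \<le> p x" using q by (auto dest: le_funD)
    show "r = q" if "sublinear r" "\<And>x. r x \<le> q x" for r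
    proof -
      have "r \<le> q" using that(2) by (rule le_funI)
      with q(2) that(1) show ?thesis by (intro min) auto
    qed
  qed
qed

text \<open>Pushing \<open>q\<close> down to at most \<open>- q x\<close> at \<open>- x\<close>
  gives a sublinear minorant, which by minimality is \<open>q\<close> itself. So \<open>q\<close> is
  odd, and an odd sublinear functional is linear.\<close>

lemma minimal_sublinear_imp_linear:
  fixes q :: "'a::real_vector \<Rightarrow> real"
  assumes q: "sublinear q" and min: "\<And>r. sublinear r \<Longrightarrow> (\<And>x. r x \<le> q x) \<Longrightarrow> r = q"
  shows "linear q"
proof -
  have minus: "q (- x) = - q x" for x
  proof -
    obtain r where r: "sublinear r" "\<And>y. r y \<le> q y" "\<And>d. d \<in> {x} \<Longrightarrow> r (- d) \<le> - q x"
      by (rule sublinear_minorant_ge_on_convex[OF q, of "{x}" "q x"]) auto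
    have "r = q" using r(1,2) by (rule min)
    with r(3)[of x] sublinear_minus_ge[OF q, of x] show ?thesis by simp
  qed
  show ?thesis
  proof (rule linearI)
    fix x y
    show "q (x + y) = q x + q y"
      using sublinear_add[OF q, of x y] sublinear_add[OF q, of "- x" "- y"]
        minus[of "x + y"] minus[of x] minus[of y] by simp
  next
    fix t :: real and x
    show "q (t *\<^sub>R x) = t *\<^sub>R q x"
      using sublinear_scaleR[OF q, of t x] sublinear_scaleR[OF q, of "- t" x] minus[of "t *\<^sub>R x"]
      by (cases "0 \<le> t") auto
  qed
qed

text \<open>A linear \<open>f\<close> below the minorant \<open>q\<close> satisfies
  \<open>f (- d) \<le> - c\<close>, and linearity turns this upper bound on \<open>- D\<close> into
  the lower bound on \<open>D\<close>.\<close>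

lemma mazur_orlicz:
  fixes p :: "'a::real_vector \<Rightarrow> real"
  assumes "sublinear p" and "convex D" "D \<noteq> {}" and "\<And>d. d \<in> D \<Longrightarrow> c \<le> p d"
  obtains f where "linear f" "\<And>x. f x \<le> p x" "\<And>d. d \<in> D \<Longrightarrow> c \<le> f d"
proof -
  obtain q where q: "sublinear q" "\<And>x. q x \<le> p x" "\<And>d. d \<in> D \<Longrightarrow> q (- d) \<le> - c"
    using sublinear_minorant_ge_on_convex[OF assms] by blast
  obtain f where f: "sublinear f" "\<And>x. f x \<le> q x"
    "\<And>r. sublinear r \<Longrightarrow> (\<And>x. r x \<le> f x) \<Longrightarrow> r = f"
    using minimal_sublinear_minorant[OF q(1)] by blast
  show thesis
  proof
    show lin: "linear f" using f(1,3) by (rule minimal_sublinear_imp_linear)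
    show "f x \<le> p x" for x using f(2)[of x] q(2)[of x] by simp
    show "c \<le> f d" if "d \<in> D" for d
      using f(2)[of "- d"] q(3)[OF that] linear_neg[OF lin, of d] by simp
  qed
qed

text \<open>Mazur-Orlicz for the norm and the translate of \<open>D\<close> by \<open>- a\<close>,
  on which the norm is at least some \<open>\<delta> > 0\<close>. Domination by the norm, used at
  \<open>x\<close> and \<open>- x\<close>, also makes the functional continuous.\<close>

lemma strict_separation_point_convex:
  fixes D :: "'a::real_normed_vector set"
  assumes "convex D" "D \<noteq> {}" "a \<notin> closure D"
  obtains f :: "'a \<Rightarrow> real" and \<delta> where "bounded_linear f" "0 < \<delta>" "\<forall>x\<in>D. f a + \<delta> \<le> f x"
proof -
  obtain \<delta> where \<delta>: "0 < \<delta>" "\<And>x. x \<in> D \<Longrightarrow> \<delta> \<le> dist x a"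
    using \<open>a \<notin> closure D\<close> by (auto simp: closure_approachable not_less)
  have "convex ((+) (- a) ` D)"
    using \<open>convex D\<close> by (rule convex_translation)
  then obtain f where f: "linear f" "\<And>x. f x \<le> norm x" "\<And>d. d \<in> (+) (- a) ` D \<Longrightarrow> \<delta> \<le> f d"
    using mazur_orlicz[OF sublinear_norm, of "(+) (- a) ` D" \<delta>] \<open>D \<noteq> {}\<close> \<delta>(2)
    by (auto simp: dist_norm)
  have "norm (f x) \<le> norm x * 1" for x
    using f(2)[of x] f(2)[of "- x"] linear_neg[OF f(1), of x] by simp
  then have "bounded_linear f"
    using f(1) by (auto simp: bounded_linear_def bounded_linear_axioms_def intro!: exI[of _ 1])
  moreover have "f a + \<delta> \<le> f x" if "x \<in> D" for x
    using f(3)[of "- a + x"] that linear_diff[OF f(1), of x a] by simp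
  ultimately show thesis using \<delta>(1) that by blast
qed

section \<open>Weak \<open>K\<close>-compactness and cancellation\<close>

lemma openin_weak_topology_vimage:
  fixes f :: "'x::real_normed_vector \<Rightarrow> real"
  assumes "bounded_linear f" "open V"
  shows "openin weak_topology (f -` V)"
  unfolding weak_topology_def
  using assms by (intro topology_generated_by_Basis) auto

text \<open>The weakly open half-spaces \<open>f > - n\<close> cover everything, and adding
  \<open>K\<close> to them cannot lower \<open>f\<close>. A finite subcover therefore leaves a
  largest \<open>n\<close>, whose negative bounds \<open>f\<close> on \<open>B\<close>.\<close>

lemma weakly_K_compact_bounded_below:
  fixes f :: "'x::real_normed_vector \<Rightarrow> real"
  assumes B: "weakly_K_compact K B" and f: "bounded_linear f"
    and K: "0 \<in> K" "\<And>k. k \<in> K \<Longrightarrow> 0 \<le> f k"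
  shows "bdd_below (f ` B)"
proof -
  interpret f: bounded_linear f by (rule f)
  define U where "U n = f -` {- real n<..}" for n
  have "B \<subseteq> \<Union> (range (\<lambda>n. U n + K))"
  proof
    fix b assume "b \<in> B"
    obtain n where "- f b < real n" using reals_Archimedean2 by blast
    then have "b + 0 \<in> U n + K"
      using K(1) by (intro set_plus_intro) (auto simp: U_def)
    then show "b \<in> \<Union> (range (\<lambda>n. U n + K))" by auto
  qed
  moreover have "openin weak_topology (U n)" for n
    unfolding U_def using f by (rule openin_weak_topology_vimage) simp
  then have "\<forall>C\<in>range (\<lambda>n. U n + K). \<exists>W. openin weak_topology W \<and> C = W + K"
    by auto
  ultimately obtain \<D> where \<D>: "\<D> \<subseteq> range (\<lambda>n. U n + K)" "finite \<D>" "B \<subseteq> \<Union>\<D>"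
    using B[unfolded weakly_K_compact_def, THEN conjunct2, rule_format, of "range (\<lambda>n. U n + K)"]
    by auto
  from finite_subset_image[OF \<D>(2,1)]
  obtain N where "finite N" "\<D> = (\<lambda>n. U n + K) ` N" by auto
  with \<D>(3) have N: "finite N" "B \<subseteq> (\<Union>n\<in>N. U n + K)" by auto
  show ?thesis
  proof (rule bdd_belowI2)
    fix b assume "b \<in> B"
    then obtain n u k where nuk: "n \<in> N" "u \<in> U n" "k \<in> K" "b = u + k"
      using N(2) by (auto simp: set_plus_def)
    have "real n \<le> real (Max N)"
      using N(1) nuk(1) by simp
    with nuk K(2)[of k] show "- real (Max N) \<le> f b"
      by (auto simp: U_def f.add)
  qed
qed

lemma K_cancellation:
  fixes K :: "'x::real_normed_vector set"
  assumes "cone K" "K \<noteq> {}" and C: "K_convex K C" and B: "weakly_K_compact K B"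
    and sub: "{a} + B \<subseteq> C + B + K"
  shows "a \<in> closure (C + K)"
proof (rule ccontr)
  assume a: "a \<notin> closure (C + K)"
  have "0 \<in> K" using \<open>cone K\<close> \<open>K \<noteq> {}\<close> by (simp add: cone_contains_0)
  obtain b0 where b0: "b0 \<in> B" using B by (auto simp: weakly_K_compact_def)
  then have "a + b0 \<in> C + B + K" using sub by (auto simp: set_plus_def)
  then obtain c0 where c0: "c0 \<in> C" by (auto simp: set_plus_def)
  have "c0 + 0 \<in> C + K" using c0 \<open>0 \<in> K\<close> by (rule set_plus_intro)
  then have "C + K \<noteq> {}" by auto
  then obtain f :: "'x \<Rightarrow> real" and \<delta> where f: "bounded_linear f" and "0 < \<delta>"
    and sep: "\<forall>x\<in>C + K. f a + \<delta> \<le> f x"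
    by (rule strict_separation_point_convex[OF C[unfolded K_convex_def] _ a])
  interpret f: bounded_linear f by (rule f)
  have f_nonneg: "0 \<le> f k" if "k \<in> K" for k
  proof (rule ccontr)
    assume "\<not> 0 \<le> f k"
    \<comment> \<open>Chosen so that moving from \<open>c0\<close> by \<open>s *\<^sub>R k\<close>
      brings \<open>f\<close> strictly below \<open>f a + \<delta>\<close>, although the point stays
      in \<open>C + K\<close>.\<close>
    define s where "s = \<bar>f a + \<delta> - f c0\<bar> / (- f k) + 1"
    have "0 \<le> s" using \<open>\<not> 0 \<le> f k\<close> by (auto simp: s_def intro!: add_nonneg_nonneg divide_nonneg_pos)
    then have "s *\<^sub>R k \<in> K" using \<open>cone K\<close> that by (simp add: cone_def)
    with c0 have "c0 + s *\<^sub>R k \<in> C + K" by (rule set_plus_intro)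
    then have "f a + \<delta> \<le> f c0 + s * f k" using sep by (force simp: f.add f.scaleR)
    moreover have "s * f k = - \<bar>f a + \<delta> - f c0\<bar> + f k"
      using \<open>\<not> 0 \<le> f k\<close> by (simp add: s_def field_simps)
    ultimately show False using \<open>\<not> 0 \<le> f k\<close> by linarith
  qed
  have bdd: "bdd_below (f ` B)"
    using B f \<open>0 \<in> K\<close> f_nonneg by (rule weakly_K_compact_bounded_below)
  \<comment> \<open>Writing \<open>a + b = c + b' + k\<close> and using
    \<open>f (c + k) \<ge> f a + \<delta>\<close> gives \<open>f b \<ge> f b' + \<delta>\<close>.
    All values of \<open>f\<close> on \<open>B\<close> then exceed their finite infimum by
    \<open>\<delta>\<close>, which is absurd.\<close>
  have "(INF b\<in>B. f b) + \<delta> \<le> f b" if "b \<in> B" for b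
  proof -
    have "a + b \<in> C + B + K" using sub that by (auto simp: set_plus_def)
    then obtain c b' k where cbk: "a + b = c + b' + k" "c \<in> C" "b' \<in> B" "k \<in> K"
      by (auto simp: set_plus_def)
    have "f a + \<delta> \<le> f (c + k)" using cbk by (intro sep[rule_format] set_plus_intro)
    moreover have "f (a + b) = f (c + b' + k)" using cbk(1) by simp
    moreover have "(INF b\<in>B. f b) \<le> f b'" using bdd cbk(3) by (rule cINF_lower)
    ultimately show ?thesis by (simp add: f.add)
  qed
  then have "(INF b\<in>B. f b) + \<delta> \<le> (INF b\<in>B. f b)"
    using b0 by (intro cINF_greatest) auto
  with \<open>0 < \<delta>\<close> show False by simp
qed

section \<open>Convex cones and their interiors\<close>

lemma convex_cone_add_closed:
  assumes "convex K" "cone K" "x \<in> K" "y \<in> K"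
  shows "x + y \<in> K"
  using assms convex_cone[of K] by blast

text \<open>The translate of \<open>interior K\<close> by \<open>k\<close> is an open subset of
  \<open>K\<close>, hence lies in the interior.\<close>

lemma cone_add_interior:
  fixes K :: "'x::real_normed_vector set"
  assumes "convex K" "cone K" "k \<in> K" "u \<in> interior K"
  shows "k + u \<in> interior K"
proof -
  have "(+) k ` interior K \<subseteq> interior K"
  proof (rule interior_maximal)
    show "(+) k ` interior K \<subseteq> K"
      using assms(1-3) interior_subset[of K] by (auto intro: convex_cone_add_closed)
  qed (simp add: open_translation)
  with assms(4) show ?thesis by auto
qed

lemma cone_scaleR_interior:
  fixes K :: "'x::real_normed_vector set"
  assumes "cone K" "0 < t" "u \<in> interior K"
  shows "t *\<^sub>R u \<in> interior K"
proof -
  have "(*\<^sub>R) t ` interior K \<subseteq> interior K"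
  proof (rule interior_maximal)
    show "(*\<^sub>R) t ` interior K \<subseteq> K"
      using assms(1,2) interior_subset[of K] by (auto simp: cone_def)
  qed (use assms(2) in \<open>simp add: open_scaling\<close>)
  with assms(3) show ?thesis by auto
qed

text \<open>Approximate \<open>y\<close> by some \<open>c + k\<close> to within the radius of a ball
  around \<open>u\<close> inside \<open>interior K\<close>: the error, added to \<open>u\<close>,
  stays in that ball.\<close>

lemma closure_add_interior:
  fixes K :: "'x::real_normed_vector set"
  assumes "convex K" "cone K" "y \<in> closure (C + K)" "u \<in> interior K"
  shows "y + u \<in> C + interior K"
proof -
  obtain r where r: "0 < r" "ball u r \<subseteq> interior K"
    using assms(4) open_contains_ball open_interior by blast
  obtain c k where ck: "c \<in> C" "k \<in> K" "dist (c + k) y < r"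
    using assms(3) r(1) by (auto simp: closure_approachable set_plus_def)
  then have "u + y - (c + k) \<in> ball u r"
    by (simp add: dist_norm algebra_simps)
  with r(2) have "k + (u + y - (c + k)) \<in> interior K"
    using assms(1,2) ck(2) by (intro cone_add_interior) auto
  with ck(1) have "c + (k + (u + y - (c + k))) \<in> C + interior K"
    by (rule set_plus_intro)
  then show ?thesis by (simp add: algebra_simps)
qed

section \<open>The error bound\<close>

theorem proposition3p19:
  fixes K :: "'x::real_normed_vector set"
    and F H :: "'z::real_normed_vector \<Rightarrow> 'x set"
    and M :: "'z set"
    and e :: 'x
    and \<mu> L \<epsilon> :: real
    and zbar zeps :: 'z
  assumes "closed K" and "convex K" and "cone K" and "pointed K" and "interior K \<noteq> {}"
    and "closed M" and "M \<noteq> {}"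
    and "e \<in> interior K"
    and "\<mu> > 0" and "L \<in> {0<..<\<mu>}" and "\<epsilon> > 0"
    and "zbar \<in> M" and "zeps \<in> M"
    and "\<forall>z\<in>M. \<not> F zbar \<subseteq> F z + {- ((\<mu> * norm (z - zbar)) *\<^sub>R e)} + interior K"
    and "\<forall>z\<in>M. H z + {(L * norm (z - zbar)) *\<^sub>R e} \<subseteq> H zbar + K"
    and "\<forall>z\<in>M. (F + H) z \<subseteq> (F + H) zeps + {- (\<epsilon> *\<^sub>R e)} + K"
    and "K_convex K (F zeps)"
    and "weakly_K_compact K (H zbar)"
  shows "norm (zeps - zbar) \<le> \<epsilon> / (\<mu> - L)"
proof (rule ccontr)
  define t where "t = norm (zeps - zbar)"
  define v where "v = (\<epsilon> + L * t) *\<^sub>R e"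
  define \<eta> where "\<eta> = \<mu> * t - (\<epsilon> + L * t)"
  assume "\<not> norm (zeps - zbar) \<le> \<epsilon> / (\<mu> - L)"
  \<comment> \<open>Multiplying the negated bound by \<open>\<mu> - L > 0\<close> gives
    \<open>\<epsilon> + L * t < \<mu> * t\<close>.\<close>
  with assms(10) have "0 < \<eta>" by (simp add: \<eta>_def t_def field_simps)
  have "K \<noteq> {}" using assms(5) interior_subset by blast
  have "F zbar \<subseteq> F zeps + {- ((\<mu> * t) *\<^sub>R e)} + interior K"
  proof
    fix a assume a: "a \<in> F zbar"
    have "{a + v} + H zbar \<subseteq> F zeps + H zbar + K"
    proof
      fix x assume "x \<in> {a + v} + H zbar"
      then obtain b where b: "b \<in> H zbar" "x = a + v + b" by (auto simp: set_plus_def)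
      have "a + b \<in> (F + H) zbar" using a b(1) by (auto simp: set_plus_def)
      then have "a + b \<in> (F + H) zeps + {- (\<epsilon> *\<^sub>R e)} + K" using assms(12,16) by blast
      then obtain c h k where k: "c \<in> F zeps" "h \<in> H zeps" "k \<in> K"
        "a + b = c + h - \<epsilon> *\<^sub>R e + k"
        by (auto simp: set_plus_def)
      have "h + (L * t) *\<^sub>R e \<in> H zeps + {(L * norm (zeps - zbar)) *\<^sub>R e}"
        using k(2) by (auto simp: set_plus_def t_def)
      then have "h + (L * t) *\<^sub>R e \<in> H zbar + K" using assms(13,15) by blast
      then obtain b' k' where k': "b' \<in> H zbar" "k' \<in> K" "h + (L * t) *\<^sub>R e = b' + k'"
        by (auto simp: set_plus_def)
      have "x = (a + b) + \<epsilon> *\<^sub>R e + (L * t) *\<^sub>R e"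
        by (simp add: b(2) v_def algebra_simps)
      also have "\<dots> = c + (h + (L * t) *\<^sub>R e) + k"
        by (simp add: k(4))
      also have "\<dots> = c + b' + (k' + k)"
        \<comment> \<open>The element \<open>h\<close> of \<open>H zeps\<close> has been traded for
          \<open>b'\<close> in \<open>H zbar\<close>, so that the same set stands on both sides of
          the inclusion and can be cancelled.\<close>
        by (simp add: k'(3))
      also have "\<dots> \<in> F zeps + H zbar + K"
        using k k' assms(2,3) by (intro set_plus_intro) (auto intro: convex_cone_add_closed)
      finally show "x \<in> F zeps + H zbar + K" .
    qed
    then have "a + v \<in> closure (F zeps + K)"
      using assms(3) \<open>K \<noteq> {}\<close> assms(17,18) by (intro K_cancellation)
    \<comment> \<open>By the choice of \<open>\<eta>\<close>, the total shift
      \<open>v + \<eta> *\<^sub>R e\<close> is \<open>(\<mu> * t) *\<^sub>R e\<close>, exactly the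
      one in (i) at \<open>zeps\<close>.\<close>
    then have "(a + v) + \<eta> *\<^sub>R e \<in> F zeps + interior K"
      using assms(2,3,8) \<open>0 < \<eta>\<close> by (intro closure_add_interior cone_scaleR_interior)
    then obtain c u where cu: "c \<in> F zeps" "u \<in> interior K" "a + v + \<eta> *\<^sub>R e = c + u"
      by (auto simp: set_plus_def)
    have "a = (a + v + \<eta> *\<^sub>R e) - (\<mu> * t) *\<^sub>R e"
      by (simp add: v_def \<eta>_def algebra_simps)
    also have "\<dots> = c + - ((\<mu> * t) *\<^sub>R e) + u"
      by (simp add: cu(3))
    also have "\<dots> \<in> F zeps + {- ((\<mu> * t) *\<^sub>R e)} + interior K"
      using cu by (intro set_plus_intro) auto
    finally show "a \<in> F zeps + {- ((\<mu> * t) *\<^sub>R e)} + interior K" .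
  qed
  with assms(13,14) show False by (auto simp: t_def)
qed

end
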